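(* Let $m\ge 1$, let $(p_i(n))_{n\ge 0}$, $1\le i\le m$, be sequences of nonnegative real numbers, and let $(\tau_i(n))_{n\ge 0}$, $1\le i\le m$, be sequences of integers such that $\tau_i(n)\le n-1$ for all $n\ge 0$ and $\lim_{n\to\infty}\tau_i(n)=\infty$, $1\le i\le m$. If $$\liminf_{n\to\infty}\sum_{i=1}^{m}\sum_{j=\tau_k(n)}^{n-1}p_i(j)>\frac1e,\qquad k=1,\dots,m,$$ then all solutions of the difference equation $$\Delta x(n)+\sum_{i=1}^m p_i(n)\,x(\tau_i(n))=0,\qquad n\ge 0,$$ oscillate.
   Context: $\Delta x(n)=x(n+1)-x(n)$. Let $w=-\min_{n\ge0,\,1\le i\le m}\tau_i(n)$ (a finite positive integer). A solution of the equation is a real sequence $(x(n))_{n\ge -w}$ satisfying the equation for all $n\ge 0$. A solution is oscillatory (oscillates) if it is neither eventually positive nor eventually negative. *)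

theory Defs
  imports Complex_Main "HOL-Library.Extended_Real" "HOL-Library.Liminf_Limsup"
begin

definition fwd_diff :: "(int \<Rightarrow> real) \<Rightarrow> int \<Rightarrow> real" where
  "fwd_diff x n = x (n + 1) - x n"

text \<open>
  A sequence \<open>(x n)\<close>, \<open>n \<ge> - w\<close>, is represented by a total function on the integers.
  With \<open>- w\<close> the least value of the delayed arguments \<open>\<tau> i n\<close> (attained, and negative, when
  \<open>\<tau> i n \<le> n - 1\<close> and \<open>\<tau> i n\<close> tends to infinity), neither the equation nor
  oscillation depends on values at arguments below \<open>- w\<close>, so every sequence on
  \<open>n \<ge> - w\<close> is covered through any extension.
\<close>

definition is_solution ::
  "nat \<Rightarrow> (nat \<Rightarrow> nat \<Rightarrow> real) \<Rightarrow> (nat \<Rightarrow> nat \<Rightarrow> int) \<Rightarrow> (int \<Rightarrow> real) \<Rightarrow> bool" where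
  "is_solution m p \<tau> x \<longleftrightarrow>
     (\<forall>n::nat. fwd_diff x (int n) + (\<Sum>i=1..m. p i n * x (\<tau> i n)) = 0)"

definition oscillatory :: "(int \<Rightarrow> real) \<Rightarrow> bool" where
  "oscillatory x \<longleftrightarrow>
     \<not> (\<forall>\<^sub>F n in at_top. x n > 0) \<and> \<not> (\<forall>\<^sub>F n in at_top. x n < 0)"

text \<open>
  The sum of \<open>p i j\<close> over \<open>j = \<tau> k n, ..., n - 1\<close> and \<open>i = 1, ..., m\<close>. The coefficients exist
  only at nonnegative indices, so a negative lower limit is replaced by 0; when \<open>\<tau> k n\<close>
  tends to infinity this concerns finitely many \<open>n\<close> and leaves the limit inferior unchanged.
\<close>

definition delay_sum ::
  "nat \<Rightarrow> (nat \<Rightarrow> nat \<Rightarrow> real) \<Rightarrow> (nat \<Rightarrow> nat \<Rightarrow> int) \<Rightarrow> nat \<Rightarrow> nat \<Rightarrow> real" where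
  "delay_sum m p \<tau> k n = (\<Sum>i=1..m. \<Sum>j\<in>{nat (\<tau> k n)..<n}. p i j)"

end

theory Submission
  imports Defs
begin

text \<open>
  If \<open>x\<close> is an eventually positive solution, then \<open>x\<close> is eventually nonincreasing, so all delays
  may be replaced by the single nondecreasing delay \<open>s n = max {\<tau> i j | i \<le> m, j \<le> n}\<close>, for which
  \<open>x (n + 1) \<le> x n - P n * x (s n)\<close> with \<open>P = (\<Sum>i. p i)\<close>, and still \<open>(\<Sum>j=s n..<n. P j) \<ge> c > 1/e\<close>.
  A lower bound \<open>r\<close> for the ratio \<open>x (s n) / x n\<close> improves to \<open>exp (r c) \<ge> e c r\<close>, hence the ratio
  tends to infinity. On the other hand, splitting \<open>{s n..<n}\<close> at a point \<open>q\<close> into two parts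
  of weight at least \<open>c/2\<close> shows that the ratio at \<open>q\<close> is at most \<open>4/c\<^sup>2\<close>.
\<close>

text \<open>Each step multiplies \<open>y\<close> by at most \<open>1 - r * P n\<close>, which is at
  most \<open>exp (- r * P n)\<close>; the product over \<open>{a..<b}\<close> turns the sum into
  the exponent.\<close>

lemma exp_decay_of_ratio_bound:
  fixes y P :: "nat \<Rightarrow> real"
  assumes pos: "\<And>n. n \<ge> M \<Longrightarrow> y n > 0"
    and P: "\<And>n. n \<ge> M \<Longrightarrow> P n \<ge> 0"
    and ineq: "\<And>n. n \<ge> M \<Longrightarrow> y (Suc n) \<le> y n - P n * y (s n)"
    and ratio: "\<And>n. n \<ge> M \<Longrightarrow> r * y n \<le> y (s n)"
    and "M \<le> a" "a \<le> b"
  shows "y b \<le> y a * exp (- r * sum P {a..<b})"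
  using \<open>a \<le> b\<close>
proof (induction b rule: dec_induct)
  case base
  show ?case by simp
next
  case (step b)
  have b: "b \<ge> M" using \<open>M \<le> a\<close> step by simp
  have "y (Suc b) \<le> y b - P b * (r * y b)"
    using ineq[OF b] mult_left_mono[OF ratio[OF b] P[OF b]] by linarith
  also have "\<dots> = y b * (1 + (- r * P b))" by (simp add: algebra_simps)
  also have "\<dots> \<le> y b * exp (- r * P b)"
    using pos[OF b] by (intro mult_left_mono exp_ge_add_one_self) simp
  also have "\<dots> \<le> (y a * exp (- r * sum P {a..<b})) * exp (- r * P b)"
    using step by (intro mult_right_mono) auto
  also have "\<dots> = y a * exp (- r * sum P {a..<Suc b})"
    using step by (simp add: algebra_simps flip: exp_add)
  finally show ?case .
qed

text \<open>Monotonicity gives ratio 1 at the start. Each round feeds the current bound into the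
  exponential decay over the window \<open>{s n..<n}\<close> and gains a factor
  \<open>exp 1 * c\<close>. The index from which the bound holds may grow with
  \<open>k\<close>.\<close>

lemma ratio_power_bound:
  fixes y P :: "nat \<Rightarrow> real"
  assumes pos: "\<And>n. n \<ge> N \<Longrightarrow> y n > 0"
    and P: "\<And>n. n \<ge> N \<Longrightarrow> P n \<ge> 0"
    and dec: "\<And>i j. N \<le> i \<Longrightarrow> i \<le> j \<Longrightarrow> y j \<le> y i"
    and ineq: "\<And>n. n \<ge> N \<Longrightarrow> y (Suc n) \<le> y n - P n * y (s n)"
    and s_le: "\<And>n. s n \<le> n"
    and s_lim: "filterlim s at_top sequentially"
    and weight: "\<And>n. n \<ge> N \<Longrightarrow> sum P {s n..<n} \<ge> c"
    and c: "c > 0"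
  shows "\<forall>\<^sub>F n in sequentially. (exp 1 * c) ^ k * y n \<le> y (s n)"
proof (induction k)
  case 0
  have "\<forall>\<^sub>F n in sequentially. N \<le> s n"
    using s_lim by (simp add: filterlim_at_top)
  then show ?case
    by eventually_elim (use dec s_le in simp)
next
  case (Suc k)
  define r where "r = (exp 1 * c) ^ k"
  have r: "r \<ge> 0" using c by (simp add: r_def)
  from Suc.IH obtain M0 where M0: "\<And>n. n \<ge> M0 \<Longrightarrow> r * y n \<le> y (s n)"
    by (auto simp: eventually_sequentially r_def)
  define M where "M = max M0 N"
  \<comment> \<open>The previous bound has to hold on the whole window \<open>{s n..<n}\<close>, so
    its left end must lie beyond \<open>M\<close>.\<close>
  have "\<forall>\<^sub>F n in sequentially. M \<le> s n"
    using s_lim by (simp add: filterlim_at_top)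
  then show ?case
  proof eventually_elim
    case (elim n)
    have n: "n \<ge> N" "s n \<ge> N" using elim s_le[of n] by (auto simp: M_def)
    have "y n \<le> y (s n) * exp (- r * sum P {s n..<n})"
      by (rule exp_decay_of_ratio_bound[where M = M and s = s])
        (use pos P ineq M0 elim s_le in \<open>auto simp: M_def\<close>)
    also have "\<dots> \<le> y (s n) * exp (- (r * c))"
      using mult_left_mono[OF weight[OF n(1)] r] pos[OF n(2)] by (intro mult_left_mono) auto
    finally have "y n * exp (r * c) \<le> y (s n)"
      by (simp add: exp_minus field_simps)
    moreover have "exp 1 * (r * c) \<le> exp (r * c)"
    proof -
      \<comment> \<open>The inequality 1 + u \<le> exp u at u = \<open>r * c - 1\<close> yields e t
        \<le> exp t with t = \<open>r * c\<close>.\<close>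
      have "r * c \<le> exp (r * c - 1)" using exp_ge_add_one_self[of "r * c - 1"] by simp
      then show ?thesis by (simp add: exp_diff field_simps)
    qed
    ultimately have "y n * (exp 1 * (r * c)) \<le> y (s n)"
      using pos[OF n(1)] by (meson less_imp_le mult_left_mono order_trans)
    then show ?case by (simp add: r_def mult_ac)
  qed
qed

text \<open>Each step lowers \<open>y\<close> by at least \<open>P j * y (s j)\<close>, hence by
  \<open>P j * v\<close>; the decreases telescope.\<close>

lemma decrease_ge_weight:
  fixes y P :: "nat \<Rightarrow> real"
  assumes P: "\<And>n. n \<ge> N \<Longrightarrow> P n \<ge> 0"
    and ineq: "\<And>n. n \<ge> N \<Longrightarrow> y (Suc n) \<le> y n - P n * y (s n)"
    and "N \<le> a" "a \<le> b"
    and low: "\<And>j. a \<le> j \<Longrightarrow> j < b \<Longrightarrow> v \<le> y (s j)"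
  shows "sum P {a..<b} * v \<le> y a - y b"
proof -
  have "sum P {a..<b} * v = (\<Sum>j=a..<b. P j * v)" by (simp add: sum_distrib_right)
  also have "\<dots> \<le> (\<Sum>j=a..<b. y j - y (Suc j))"
  proof (rule sum_mono)
    fix j assume j: "j \<in> {a..<b}"
    then have "P j * v \<le> P j * y (s j)"
      using P low \<open>N \<le> a\<close> by (intro mult_left_mono) auto
    with ineq[of j] j \<open>N \<le> a\<close> show "P j * v \<le> y j - y (Suc j)" by simp
  qed
  also have "\<dots> = y a - y b"
    using sum_Suc_diff'[OF \<open>a \<le> b\<close>, of "\<lambda>j. - y j"] by simp
  finally show ?thesis .
qed

text \<open>Let \<open>q\<close> be the first index at which the window from \<open>a = s n\<close>
  to \<open>n\<close> has accumulated weight \<open>c / 2\<close>. The decrease of \<open>y\<close>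
  up to \<open>Suc q\<close> bounds \<open>y (s q)\<close> by \<open>2 / c * y a\<close>, and the
  decrease from \<open>q\<close> to \<open>n\<close> bounds \<open>y a\<close> by
  \<open>2 / c * y q\<close>.\<close>

lemma ratio_bounded_infinitely_often:
  fixes y P :: "nat \<Rightarrow> real"
  assumes pos: "\<And>n. n \<ge> N \<Longrightarrow> y n > 0"
    and P: "\<And>n. n \<ge> N \<Longrightarrow> P n \<ge> 0"
    and dec: "\<And>i j. N \<le> i \<Longrightarrow> i \<le> j \<Longrightarrow> y j \<le> y i"
    and ineq: "\<And>n. n \<ge> N \<Longrightarrow> y (Suc n) \<le> y n - P n * y (s n)"
    and s_mono: "mono s"
    and s_lim: "filterlim s at_top sequentially"
    and weight: "\<And>n. n \<ge> N \<Longrightarrow> sum P {s n..<n} \<ge> c"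
    and c: "c > 0"
  shows "\<exists>q\<ge>M. y (s q) \<le> 4 / c\<^sup>2 * y q"
proof -
  have "\<forall>\<^sub>F n in sequentially. N \<le> s n"
    using s_lim by (simp add: filterlim_at_top)
  then obtain K where K: "\<And>n. n \<ge> K \<Longrightarrow> N \<le> s n"
    by (auto simp: eventually_sequentially)
  define R where "R = max N (max M K)"
  have "\<forall>\<^sub>F n in sequentially. R \<le> s n \<and> R \<le> n"
    using s_lim by (auto simp: filterlim_at_top eventually_conj_iff eventually_ge_at_top)
  then obtain n where n: "R \<le> s n" "R \<le> n"
    by (auto simp: eventually_sequentially)
  define a where "a = s n"
  have wn: "sum P {a..<n} \<ge> c" using weight n by (simp add: a_def R_def)
  have an: "a < n" using wn c by (cases "a < n") auto
  have aN: "N \<le> a" "M \<le> a" "K \<le> a" using n by (auto simp: a_def R_def)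
  \<comment> \<open>The term at \<open>q\<close> is counted in both parts,
    \<open>{a..<Suc q}\<close> and \<open>{q..<n}\<close>, so each has weight at least
    \<open>c / 2\<close> however large \<open>P q\<close> is.\<close>
  define Q where "Q q \<longleftrightarrow> a \<le> q \<and> sum P {a..<Suc q} \<ge> c / 2" for q
  have Qn: "Q (n - 1)" using wn c an by (simp add: Q_def)
  define q where "q = (LEAST q. Q q)"
  have Qq: "Q q" unfolding q_def by (rule LeastI[of Q, OF Qn])
  then have aq: "a \<le> q" and half1: "sum P {a..<Suc q} \<ge> c / 2" by (auto simp: Q_def)
  have qn: "q < n" using Least_le[of Q, OF Qn] an by (simp add: q_def)
  have "sum P {a..<q} \<le> c / 2"
  proof (cases "q = a")
    case True
    then show ?thesis using c by simp
  next
    case False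
    then have "\<not> Q (q - 1)" using aq not_less_Least[of "q - 1" Q] by (simp add: q_def)
    then show ?thesis using False aq by (auto simp: Q_def)
  qed
  moreover have "sum P {a..<q} + sum P {q..<n} = sum P {a..<n}"
    using aq qn by (intro sum.atLeastLessThan_concat) auto
  ultimately have half2: "sum P {q..<n} \<ge> c / 2" using wn by linarith
  have sN: "N \<le> s j" if "j \<ge> a" for j using K aN that by simp
  have smono: "s i \<le> s j" if "i \<le> j" for i j using s_mono that by (rule monoD)
  \<comment> \<open>For \<open>j < n\<close> the delayed index satisfies \<open>s j\<close> \<le>
    \<open>s n = a\<close>.\<close>
  have low: "y a \<le> y (s j)" if "q \<le> j" "j < n" for j
    using that aq smono[of j n] by (intro dec sN) (auto simp: a_def)
  have "sum P {q..<n} * y a \<le> y q - y n"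
    by (rule decrease_ge_weight[where N = N and s = s])
      (use P ineq aN aq qn low in auto)
  then have 1: "c / 2 * y a \<le> y q"
    using mult_right_mono[OF half2, of "y a"] pos[of a] pos[of n] aN an by linarith
  \<comment> \<open>Here \<open>j\<close> \<le> \<open>q\<close>, so \<open>s j\<close> \<le>
    \<open>s q\<close> and \<open>y (s q)\<close> is a lower bound for
    \<open>y (s j)\<close>.\<close>
  have "sum P {a..<Suc q} * y (s q) \<le> y a - y (Suc q)"
    by (rule decrease_ge_weight[where N = N and s = s])
      (use P ineq aN aq qn sN smono dec in auto)
  then have 2: "c / 2 * y (s q) \<le> y a"
    using mult_right_mono[OF half1, of "y (s q)"] pos[of "s q"] pos[of "Suc q"] aN aq sN[OF aq]
    by linarith
  have "c / 2 * (c / 2 * y (s q)) \<le> c / 2 * y a"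
    using 2 c by (intro mult_left_mono) auto
  with 1 have "c / 2 * (c / 2 * y (s q)) \<le> y q" by linarith
  then have "y (s q) \<le> 4 / c\<^sup>2 * y q" using c by (simp add: field_simps power2_eq_square)
  with aq aN show ?thesis by (meson order_trans)
qed

text \<open>Since \<open>exp 1 * c > 1\<close>, some power of it exceeds
  \<open>4 / c\<^sup>2\<close>; the growing lower bound and the recurring upper bound then clash at
  a common index \<open>q\<close>.\<close>

lemma no_positive_solution_monotone_delay:
  fixes y P :: "nat \<Rightarrow> real"
  assumes pos: "\<And>n. n \<ge> N \<Longrightarrow> y n > 0"
    and P: "\<And>n. n \<ge> N \<Longrightarrow> P n \<ge> 0"
    and dec: "\<And>i j. N \<le> i \<Longrightarrow> i \<le> j \<Longrightarrow> y j \<le> y i"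
    and ineq: "\<And>n. n \<ge> N \<Longrightarrow> y (Suc n) \<le> y n - P n * y (s n)"
    and s_mono: "mono s"
    and s_le: "\<And>n. s n \<le> n"
    and s_lim: "filterlim s at_top sequentially"
    and weight: "\<And>n. n \<ge> N \<Longrightarrow> sum P {s n..<n} \<ge> c"
    and c: "c > 1 / exp 1"
  shows False
proof -
  have c0: "c > 0" using c by (meson exp_gt_zero less_trans zero_less_divide_1_iff)
  have "exp 1 * c > 1" using c by (simp add: field_simps)
  then obtain k where k: "4 / c\<^sup>2 < (exp 1 * c) ^ k"
    using real_arch_pow by blast
  have "\<forall>\<^sub>F n in sequentially. (exp 1 * c) ^ k * y n \<le> y (s n)"
    using pos P dec ineq s_le s_lim weight c0 by (rule ratio_power_bound)
  then obtain M where M: "\<And>n. n \<ge> M \<Longrightarrow> (exp 1 * c) ^ k * y n \<le> y (s n)"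
    by (auto simp: eventually_sequentially)
  have "\<exists>q\<ge>max M N. y (s q) \<le> 4 / c\<^sup>2 * y q"
    using pos P dec ineq s_mono s_lim weight c0 by (rule ratio_bounded_infinitely_often)
  then obtain q where q: "q \<ge> M" "q \<ge> N" "y (s q) \<le> 4 / c\<^sup>2 * y q" by auto
  have "4 / c\<^sup>2 * y q < (exp 1 * c) ^ k * y q"
    using k pos[OF q(2)] by (rule mult_strict_right_mono)
  with M[OF q(1)] q(3) show False by linarith
qed

text \<open>The several delays are replaced by one monotone delay \<open>s\<close>, which preserves
  both the decay inequality and the lower bound on the weight.\<close>

lemma no_eventually_positive_solution:
  fixes p :: "nat \<Rightarrow> nat \<Rightarrow> real" and \<tau> :: "nat \<Rightarrow> nat \<Rightarrow> int"
  assumes m: "m \<ge> 1"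
    and p: "\<And>i n. i \<in> {1..m} \<Longrightarrow> p i n \<ge> 0"
    and \<tau>_le: "\<And>i n. i \<in> {1..m} \<Longrightarrow> \<tau> i n \<le> int n - 1"
    and \<tau>_lim: "\<And>i. i \<in> {1..m} \<Longrightarrow> filterlim (\<tau> i) at_top sequentially"
    and liminf: "\<And>k. k \<in> {1..m} \<Longrightarrow>
           liminf (\<lambda>n. ereal (delay_sum m p \<tau> k n)) > ereal (1 / exp 1)"
    and sol: "is_solution m p \<tau> x"
    and x_pos: "\<forall>\<^sub>F n in at_top. x n > 0"
  shows False
proof -
  define L where "L k = liminf (\<lambda>n. ereal (delay_sum m p \<tau> k n))" for k
  \<comment> \<open>With finitely many \<open>k\<close>, a single real \<open>c\<close> fits
    strictly between 1/e and all the limits inferior.\<close>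
  have "Min (L ` {1..m}) > ereal (1 / exp 1)"
    using m liminf by (subst Min_gr_iff) (auto simp: L_def)
  then obtain c where c: "c > 1 / exp 1" "ereal c < Min (L ` {1..m})"
    using ereal_dense2 by force
  have "\<forall>\<^sub>F n in sequentially. \<forall>k\<in>{1..m}. delay_sum m p \<tau> k n > c"
  proof (rule eventually_ball_finite)
    show "\<forall>k\<in>{1..m}. \<forall>\<^sub>F n in sequentially. delay_sum m p \<tau> k n > c"
    proof
      fix k assume k: "k \<in> {1..m}"
      have "ereal c < L k" using c(2) k m by (subst (asm) Min_gr_iff) auto
      from less_LiminfD[OF this[unfolded L_def]]
      show "\<forall>\<^sub>F n in sequentially. delay_sum m p \<tau> k n > c" by simp
    qed
  qed simp
  then obtain N1 where N1: "\<And>n k. n \<ge> N1 \<Longrightarrow> k \<in> {1..m} \<Longrightarrow> delay_sum m p \<tau> k n > c"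
    unfolding eventually_sequentially by blast

  obtain X where X: "\<And>n. n \<ge> X \<Longrightarrow> x n > 0"
    using x_pos by (auto simp: eventually_at_top_linorder)
  have late: "\<exists>K. \<forall>n\<ge>K. \<forall>i\<in>{1..m}. \<tau> i n \<ge> B" for B
  proof -
    have "\<forall>\<^sub>F n in sequentially. \<forall>i\<in>{1..m}. \<tau> i n \<ge> B"
      using \<tau>_lim by (intro eventually_ball_finite) (auto simp: filterlim_at_top)
    then show ?thesis by (simp add: eventually_sequentially)
  qed
  define y where "y n = x (int n)" for n
  define P where "P n = (\<Sum>i=1..m. p i n)" for n
  \<comment> \<open>Taking all \<open>j\<close> \<le> \<open>n\<close> makes the maximum monotone in
    \<open>n\<close>. The truncation by \<open>nat\<close> matches the lower summation limit in
    \<open>delay_sum\<close>.\<close>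
  define T where "T n = (\<lambda>(i, j). nat (\<tau> i j)) ` ({1..m} \<times> {..n})" for n
  define s where "s n = Max (T n)" for n
  have T: "finite (T n)" "T n \<noteq> {}" for n using m by (auto simp: T_def)
  have s_ge: "nat (\<tau> i j) \<le> s n" if "i \<in> {1..m}" "j \<le> n" for i j n
    unfolding s_def using that T by (intro Max_ge) (auto simp: T_def)
  have s_attained: "\<exists>i\<in>{1..m}. \<exists>j\<le>n. s n = nat (\<tau> i j)" for n
  proof -
    have "s n \<in> T n" unfolding s_def using T by (rule Max_in)
    then show ?thesis by (auto simp: T_def)
  qed
  have P0: "P n \<ge> 0" for n using p by (auto simp: P_def intro: sum_nonneg)
  have s_mono: "mono s"
    unfolding s_def using T by (intro monoI Max_mono) (auto simp: T_def)
  \<comment> \<open>The bound is weak because of \<open>j = 0\<close>, where the negative delayed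
    argument is truncated to 0.\<close>
  have s_le_index: "nat (\<tau> i j) \<le> j" if "i \<in> {1..m}" for i j using \<tau>_le[OF that, of j] by simp
  have s_le: "s n \<le> n" for n
    using s_attained[of n] s_le_index by (metis order_trans)
  have s_lim: "filterlim s at_top sequentially"
    unfolding filterlim_at_top
  proof
    fix B
    have 1: "1 \<in> {1..m}" using m by simp
    with late[of "int B"] obtain K where "\<And>n. n \<ge> K \<Longrightarrow> \<tau> 1 n \<ge> int B" by blast
    then have "B \<le> s n" if "n \<ge> K" for n
      using s_ge[OF 1, of n n] that by fastforce
    then show "\<forall>\<^sub>F n in sequentially. B \<le> s n" by (auto simp: eventually_sequentially)
  qed
  \<comment> \<open>The maximum is attained at some \<open>j\<close> \<le> \<open>n\<close>,
    possibly much earlier than \<open>n\<close>. As \<open>j\<close> \<ge> \<open>s n\<close>, it is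
    still past \<open>N1\<close>, so the delay sum at \<open>j\<close> exceeds \<open>c\<close>;
    going on to \<open>n\<close> only adds nonnegative terms.\<close>
  have weight: "sum P {s n..<n} \<ge> c" if sn: "s n \<ge> N1" for n
  proof -
    obtain i j where ij: "i \<in> {1..m}" "j \<le> n" "s n = nat (\<tau> i j)" using s_attained by blast
    have "j \<ge> N1" using sn s_le_index[OF ij(1), of j] ij(3) by simp
    then have "c < delay_sum m p \<tau> i j" using N1 ij by simp
    also have "\<dots> = sum P {s n..<j}"
      unfolding delay_sum_def P_def ij(3) by (rule sum.swap)
    also have "\<dots> \<le> sum P {s n..<n}" using ij P0 by (intro sum_mono2) auto
    finally show ?thesis by simp
  qed
  from late[of X] obtain N2 where
    N2: "\<And>n i. n \<ge> N2 \<Longrightarrow> i \<in> {1..m} \<Longrightarrow> \<tau> i n \<ge> X" by blast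
  have step: "y (Suc n) = y n - (\<Sum>i=1..m. p i n * x (\<tau> i n))" for n
    using sol by (simp add: is_solution_def fwd_diff_def y_def algebra_simps)
  have decr: "y (Suc n) \<le> y n" if "n \<ge> N2" for n
  proof -
    have "(\<Sum>i=1..m. p i n * x (\<tau> i n)) \<ge> 0"
      using p N2[OF that] X by (intro sum_nonneg mult_nonneg_nonneg) (auto intro: less_imp_le)
    then show ?thesis using step[of n] by simp
  qed
  have dec: "y j \<le> y i" if "N2 \<le> i" "i \<le> j" for i j
    using that(2)
  proof (induction j rule: dec_induct)
    case (step k)
    then show ?case using decr[of k] that(1) by simp
  qed simp
  from late[of "int N2"] obtain N3 where
    N3: "\<And>n i. n \<ge> N3 \<Longrightarrow> i \<in> {1..m} \<Longrightarrow> \<tau> i n \<ge> int N2" by blast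
  obtain N4 where N4: "\<And>n. n \<ge> N4 \<Longrightarrow> s n \<ge> N1"
    using s_lim by (auto simp: filterlim_at_top eventually_sequentially)
  \<comment> \<open>The four thresholds secure positivity, monotonicity, delayed arguments inside
    the monotone range, and the weight bound.\<close>
  define N where "N = max (nat X) (max N2 (max N3 N4))"
  have ineq: "y (Suc n) \<le> y n - P n * y (s n)" if "n \<ge> N" for n
  proof -
    have "P n * y (s n) = (\<Sum>i=1..m. p i n * y (s n))" by (simp add: P_def sum_distrib_right)
    also have "\<dots> \<le> (\<Sum>i=1..m. p i n * x (\<tau> i n))"
    proof (intro sum_mono mult_left_mono)
      fix i assume i: "i \<in> {1..m}"
      have \<tau>: "\<tau> i n \<ge> int N2" using N3 i that by (simp add: N_def)
      then have "y (s n) \<le> y (nat (\<tau> i n))"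
        using s_ge[OF i, of n n] by (intro dec) auto
      then show "y (s n) \<le> x (\<tau> i n)" using \<tau> by (simp add: y_def)
    qed (use p in auto)
    finally show ?thesis using step[of n] by simp
  qed
  show False
    by (rule no_positive_solution_monotone_delay[where N = N and y = y and P = P and s = s and c = c])
      (use X P0 dec ineq s_mono s_le s_lim weight N4 c in \<open>auto simp: N_def y_def\<close>)
qed

theorem theorem3p4:
  fixes m :: nat
    and p :: "nat \<Rightarrow> nat \<Rightarrow> real"
    and \<tau> :: "nat \<Rightarrow> nat \<Rightarrow> int"
  assumes "m \<ge> 1"
    and "\<And>i n. i \<in> {1..m} \<Longrightarrow> p i n \<ge> 0"
    and "\<And>i n. i \<in> {1..m} \<Longrightarrow> \<tau> i n \<le> int n - 1"
    and "\<And>i. i \<in> {1..m} \<Longrightarrow> filterlim (\<tau> i) at_top sequentially"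
    and "\<And>k. k \<in> {1..m} \<Longrightarrow>
           liminf (\<lambda>n. ereal (delay_sum m p \<tau> k n)) > ereal (1 / exp 1)"
  shows "\<forall>x. is_solution m p \<tau> x \<longrightarrow> oscillatory x"
proof (intro allI impI)
  fix x assume x: "is_solution m p \<tau> x"
  \<comment> \<open>By linearity \<open>- x\<close> is also a solution, which reduces the eventually
    negative case to the positive one.\<close>
  have "fwd_diff (\<lambda>n. - x n) (int n) + (\<Sum>i=1..m. p i n * - x (\<tau> i n))
      = - (fwd_diff x (int n) + (\<Sum>i=1..m. p i n * x (\<tau> i n)))" for n
    by (simp add: fwd_diff_def sum_negf)
  with x have neg: "is_solution m p \<tau> (\<lambda>n. - x n)"
    unfolding is_solution_def by simp
  have "\<not> (\<forall>\<^sub>F n in at_top. x n > 0)"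
    using no_eventually_positive_solution[OF assms x] by blast
  moreover have "\<not> (\<forall>\<^sub>F n in at_top. - x n > 0)"
    using no_eventually_positive_solution[OF assms neg] by blast
  ultimately show "oscillatory x" by (simp add: oscillatory_def)
qed

end
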